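(* Let $n,m,k$ be positive integers with $1 < k < n$, $mk\leq 2n$, and $k-(k\bmod 2) \geq 2\sqrt{n}$. Then there exists an $(n,m,k)$-assignment mechanism that is impartial and $\alpha$-optimal with $$\alpha = \frac{k-(k\bmod 2)}{2k\left\lceil \frac{2n}{k-(k\bmod 2)} \right\rceil}.$$
   Context: Write $[n]=\{1,\ldots,n\}$, and let $\mathcal{A}_n$ be the set of $n\times n$ real matrices with non-negative entries and zero diagonal. For $A\in\mathcal{A}_n$, $A_{-i}$ denotes the matrix obtained from $A$ by removing its $i$-th row, and for $S\subseteq[n]$ let $\sigma(S;A)=\sum_{i\in[n],\,j\in S}A_{ij}$. Let $m\le n$ and $k<n$. Instances are tuples $\mathbf{A}=(A_1,\ldots,A_m)\in\mathcal{A}_n^m$ ($A_\ell$ gives the weighted votes for job $\ell\in[m]$). The set $\mathcal{X}_k$ of feasible assignments consists of all $\mathbf{X}=(X_1,\ldots,X_m)\in(2^{[n]})^m$ with $|X_i|\le k$ for every $i\in[m]$ and $X_i\cap X_j=\emptyset$ for all $i\neq j$. Let $\sigma(\mathbf{X};\mathbf{A})=\sum_{\ell\in[m]}\sigma(X_\ell;A_\ell)$ and let $\mathrm{OPT}_k(\mathbf{A})$ be an arbitrary $\mathbf{X}\in\mathcal{X}_k$ maximizing $\sigma(\mathbf{X};\mathbf{A})$. An $(n,m,k)$-assignment mechanism is a function $f\colon\mathcal{A}_n^m\to(2^{[n]})^m$ with $f(\mathbf{A})\in\mathcal{X}_k$ for every $\mathbf{A}$. It is impartial if for all $\mathbf{A},\mathbf{A}'\in\mathcal{A}_n^m$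 and all $i\in[n]$ with $(A_\ell)_{-i}=(A'_\ell)_{-i}$ for every $\ell\in[m]$, we have $(f(\mathbf{A}))_\ell\cap\{i\}=(f(\mathbf{A}'))_\ell\cap\{i\}$ for every $\ell\in[m]$. For $\alpha\in[0,1]$, it is $\alpha$-optimal if $\sigma(f(\mathbf{A});\mathbf{A})\ge\alpha\cdot\sigma(\mathrm{OPT}_k(\mathbf{A});\mathbf{A})$ for all $\mathbf{A}\in\mathcal{A}_n^m$. *)

theory Defs
  imports Complex_Main "HOL-Library.Disjoint_Sets"
begin

(* Matrices and tuples over [n] = {1..n} and [m] = {1..m} are extensional functions on these
   index sets, so that equality of HOL functions is equality of matrices (tuples). *)

type_synonym matrix = "nat \<Rightarrow> nat \<Rightarrow> real"
type_synonym inst = "nat \<Rightarrow> matrix"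
type_synonym assignment = "nat \<Rightarrow> nat set"

definition matrices :: "nat \<Rightarrow> matrix set" where
  "matrices n = {A \<in> {1..n} \<rightarrow>\<^sub>E {1..n} \<rightarrow>\<^sub>E {0..}. \<forall>i\<in>{1..n}. A i i = 0}"

definition instances :: "nat \<Rightarrow> nat \<Rightarrow> inst set" where
  "instances n m = {1..m} \<rightarrow>\<^sub>E matrices n"

text \<open>The matrix without its \<open>i\<close>-th row; the remaining rows keep their indices.\<close>

definition remove_row :: "nat \<Rightarrow> nat \<Rightarrow> matrix \<Rightarrow> matrix" where
  "remove_row n i A = restrict A ({1..n} - {i})"

definition score_set :: "nat \<Rightarrow> nat set \<Rightarrow> matrix \<Rightarrow> real" where
  "score_set n S A = (\<Sum>i\<in>{1..n}. \<Sum>j\<in>S. A i j)"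

definition score :: "nat \<Rightarrow> nat \<Rightarrow> assignment \<Rightarrow> inst \<Rightarrow> real" where
  "score n m X A = (\<Sum>l\<in>{1..m}. score_set n (X l) (A l))"

definition feasible :: "nat \<Rightarrow> nat \<Rightarrow> nat \<Rightarrow> assignment set" where
  "feasible n m k =
     {X \<in> {1..m} \<rightarrow>\<^sub>E Pow {1..n}. (\<forall>l\<in>{1..m}. card (X l) \<le> k) \<and> disjoint_family_on X {1..m}}"

text \<open>An arbitrary maximizer, given by Hilbert choice; one exists, see \<open>OPT_maximizes\<close>.\<close>

definition OPT :: "nat \<Rightarrow> nat \<Rightarrow> nat \<Rightarrow> inst \<Rightarrow> assignment" where
  "OPT n m k A = arg_max_on (\<lambda>X. score n m X A) (feasible n m k)"

text \<open>Mechanisms are HOL functions of which only the values on \<open>instances n m\<close> matter.\<close>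

definition assignment_mechanism :: "nat \<Rightarrow> nat \<Rightarrow> nat \<Rightarrow> (inst \<Rightarrow> assignment) \<Rightarrow> bool" where
  "assignment_mechanism n m k f \<longleftrightarrow> f \<in> instances n m \<rightarrow> feasible n m k"

definition impartial :: "nat \<Rightarrow> nat \<Rightarrow> (inst \<Rightarrow> assignment) \<Rightarrow> bool" where
  "impartial n m f \<longleftrightarrow>
     (\<forall>A\<in>instances n m. \<forall>A'\<in>instances n m. \<forall>i\<in>{1..n}.
        (\<forall>l\<in>{1..m}. remove_row n i (A l) = remove_row n i (A' l)) \<longrightarrow>
        (\<forall>l\<in>{1..m}. f A l \<inter> {i} = f A' l \<inter> {i}))"

definition optimal_mechanism ::
    "nat \<Rightarrow> nat \<Rightarrow> nat \<Rightarrow> real \<Rightarrow> (inst \<Rightarrow> assignment) \<Rightarrow> bool" where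
  "optimal_mechanism n m k \<alpha> f \<longleftrightarrow>
     (\<forall>A\<in>instances n m. score n m (f A) A \<ge> \<alpha> * score n m (OPT n m k A) A)"

lemma finite_feasible: "finite (feasible n m k)"
  unfolding feasible_def by (simp add: finite_PiE)

lemma feasible_nonempty: "feasible n m k \<noteq> {}"
proof -
  have "restrict (\<lambda>_. {}) {1..m} \<in> feasible n m k"
    by (auto simp: feasible_def disjoint_family_on_def)
  then show ?thesis by blast
qed

lemma OPT_maximizes:
  "OPT n m k A \<in> feasible n m k \<and> (\<forall>X\<in>feasible n m k. score n m X A \<le> score n m (OPT n m k A) A)"
proof -
  let ?s = "\<lambda>X. score n m X A"
  have fin: "finite (?s ` feasible n m k)" and ne: "?s ` feasible n m k \<noteq> {}"
    by (simp_all add: finite_feasible feasible_nonempty)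
  obtain Y where Y: "Y \<in> feasible n m k" "?s Y = Max (?s ` feasible n m k)"
    using Max_in[OF fin ne] by auto
  have "is_arg_max ?s (\<lambda>X. X \<in> feasible n m k) Y"
    unfolding is_arg_max_linorder using Y fin by auto
  then have "is_arg_max ?s (\<lambda>X. X \<in> feasible n m k) (OPT n m k A)"
    unfolding OPT_def arg_max_on_def arg_max_def by (rule someI[where P = "is_arg_max ?s (\<lambda>X. X \<in> feasible n m k)"])
  then show ?thesis unfolding is_arg_max_linorder by blast
qed

end

theory Submission imports Defs "HOL-Number_Theory.Cong" begin

text \<open>
  Put \<open>h = k div 2\<close> and \<open>r = \<lceil>n / h\<rceil>\<close>, so that \<open>m \<le> r \<le> h\<close>. Place the agents in a grid with \<open>h\<close>
  rows of length \<open>r\<close>. The rows and the cyclic diagonals are two partitions into at most \<open>h\<close> groups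
  of size at most \<open>r\<close>, and two distinct agents never share both a row and a diagonal. For each
  partition, every group assigns its members to pairwise distinct jobs, choosing among \<open>r\<close> cyclic
  shifts one that maximizes the votes coming from outside the group. This is impartial, and by
  averaging over the shifts it attains a fraction \<open>1 / r\<close> of the votes counted. The rows count the votes
  between different rows, the diagonals those within a row, so together they count every vote.
  Finally each agent takes the better of its two jobs, which costs a factor \<open>2\<close> and gives each job
  at most \<open>2 * h \<le> k\<close> agents.
\<close>

section \<open>Votes counted under a relation\<close>

text \<open>\<open>M j i\<close> means that the vote of \<open>j\<close> for \<open>i\<close>
  counts. The value 0 outside \<open>{1..m}\<close> makes the dummy jobs between \<open>m\<close>
  and \<open>r\<close> worthless.\<close>

definition counted_votes :: "nat \<Rightarrow> nat \<Rightarrow> (nat \<Rightarrow> nat \<Rightarrow> bool) \<Rightarrow> inst \<Rightarrow> nat \<Rightarrow> nat \<Rightarrow> real" where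
  "counted_votes n m M A i l =
     (if l \<in> {1..m} then \<Sum>j\<in>{j\<in>{1..n}. M j i}. A l j i else 0)"

lemma instances_nonneg:
  assumes "A \<in> instances n m" "l \<in> {1..m}" "i \<in> {1..n}" "j \<in> {1..n}"
  shows "0 \<le> A l i j"
  using assms by (simp add: instances_def matrices_def PiE_iff)

lemma instances_diagonal:
  assumes "A \<in> instances n m" "l \<in> {1..m}" "i \<in> {1..n}"
  shows "A l i i = 0"
  using assms by (simp add: instances_def matrices_def PiE_iff)

lemma remove_row_eqD:
  assumes "remove_row n i A = remove_row n i A'" "j \<in> {1..n}" "j \<noteq> i"
  shows "A j = A' j"
  using fun_cong[OF assms(1), of j] assms(2,3) by (simp add: remove_row_def)

lemma counted_votes_cong:
  assumes "\<And>l j. l \<in> {1..m} \<Longrightarrow> j \<in> {1..n} \<Longrightarrow> M j x \<Longrightarrow> A l j = A' l j"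
  shows "counted_votes n m M A x = counted_votes n m M A' x"
  using assms by (auto simp: counted_votes_def fun_eq_iff intro!: sum.cong)

lemma counted_votes_le:
  assumes "A \<in> instances n m" "i \<in> {1..n}" "l \<in> {1..m}"
  shows "counted_votes n m M A i l \<le> (\<Sum>j\<in>{1..n}. A l j i)"
  using assms by (auto simp: counted_votes_def instances_nonneg intro!: sum_mono2)

lemma sum_cyclic_shift:
  fixes f :: "nat \<Rightarrow> 'a::comm_monoid_add"
  assumes "0 < r"
  shows "(\<Sum>s<r. f ((c + s) mod r)) = (\<Sum>s<r. f s)"
proof -
  have "inj_on (\<lambda>s. (c + s) mod r) {..<r}"
  proof (rule inj_onI)
    fix s t assume "s \<in> {..<r}" "t \<in> {..<r}" "(c + s) mod r = (c + t) mod r"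
    then have "s mod r = t mod r"
      using cong_add_lcancel_nat[of c s t r] by (simp add: cong_def)
    then show "s = t"
      using \<open>s \<in> {..<r}\<close> \<open>t \<in> {..<r}\<close> by simp
  qed
  then have "bij_betw (\<lambda>s. (c + s) mod r) {..<r} {..<r}"
    using assms by (intro bij_betw_imageI endo_inj_surj) auto
  then show ?thesis
    by (rule sum.reindex_bij_betw)
qed

section \<open>One partition: a cyclic shift for each group\<close>

text \<open>\<open>g\<close> is the group of an agent and \<open>c\<close> its slot there. Distinct
  slots become distinct jobs under a common shift; \<open>counted_across\<close> keeps the members'
  own votes out of the value of their group.\<close>

locale slotted_groups =
  fixes n m r h :: nat and g c :: "nat \<Rightarrow> nat" and M :: "nat \<Rightarrow> nat \<Rightarrow> bool"
  assumes r_pos: "0 < r"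
    and m_le_r: "m \<le> r"
    and g_less: "i \<in> {1..n} \<Longrightarrow> g i < h"
    and c_less: "c i < r"
    and slots_distinct: "\<lbrakk>i \<in> {1..n}; j \<in> {1..n}; g i = g j; c i = c j\<rbrakk> \<Longrightarrow> i = j"
    and counted_across: "\<lbrakk>i \<in> {1..n}; j \<in> {1..n}; M j i\<rbrakk> \<Longrightarrow> g j \<noteq> g i"
begin

text \<open>Jobs beyond \<open>m\<close> stand for remaining unassigned.\<close>

definition job :: "nat \<Rightarrow> nat \<Rightarrow> nat" where
  "job s i = Suc ((c i + s) mod r)"

definition group_value :: "inst \<Rightarrow> nat \<Rightarrow> nat \<Rightarrow> real" where
  "group_value A b s = (\<Sum>i\<in>{i\<in>{1..n}. g i = b}. counted_votes n m M A i (job s i))"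

definition best_shift :: "inst \<Rightarrow> nat \<Rightarrow> nat" where
  "best_shift A b = arg_max_on (group_value A b) {..<r}"

definition group_choice :: "inst \<Rightarrow> nat \<Rightarrow> nat" where
  "group_choice A i = job (best_shift A (g i)) i"

lemma group_value_best_shift:
  assumes "s < r"
  shows "group_value A b s \<le> group_value A b (best_shift A b)"
proof -
  have fin: "finite (group_value A b ` {..<r})" and ne: "group_value A b ` {..<r} \<noteq> {}"
    using r_pos by auto
  obtain t where "t < r" "group_value A b t = Max (group_value A b ` {..<r})"
    using Max_in[OF fin ne] by auto
  then have "is_arg_max (group_value A b) (\<lambda>s. s \<in> {..<r}) t"
    unfolding is_arg_max_linorder using fin by auto
  then have "is_arg_max (group_value A b) (\<lambda>s. s \<in> {..<r}) (best_shift A b)"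
    unfolding best_shift_def arg_max_on_def arg_max_def
    by (rule someI[where P = "is_arg_max (group_value A b) (\<lambda>s. s \<in> {..<r})"])
  then show ?thesis
    using assms unfolding is_arg_max_linorder by blast
qed

text \<open>As \<open>s\<close> varies, agent \<open>i\<close> meets each job from 1 to
  \<open>r\<close> exactly once, and those beyond \<open>m\<close> contribute 0.\<close>

lemma sum_counted_votes_job:
  "(\<Sum>s<r. counted_votes n m M A i (job s i)) = (\<Sum>l\<in>{1..m}. counted_votes n m M A i l)"
proof -
  have "(\<Sum>s<r. counted_votes n m M A i (job s i)) = (\<Sum>s<r. counted_votes n m M A i (Suc s))"
    unfolding job_def by (rule sum_cyclic_shift[OF r_pos])
  also have "\<dots> = (\<Sum>s<m. counted_votes n m M A i (Suc s))"
    using m_le_r by (intro sum.mono_neutral_right) (auto simp: counted_votes_def)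
  also have "\<dots> = (\<Sum>l\<in>{1..m}. counted_votes n m M A i l)"
    by (simp add: sum.atLeast1_atMost_eq)
  finally show ?thesis .
qed

lemma sum_over_groups:
  fixes f :: "nat \<Rightarrow> real"
  shows "(\<Sum>b<h. \<Sum>i\<in>{i\<in>{1..n}. g i = b}. f i) = (\<Sum>i\<in>{1..n}. f i)"
  using g_less by (intro sum.group) auto

text \<open>Averaging: in every group the best shift is worth at least the mean over the
  \<open>r\<close> shifts.\<close>

lemma sum_counted_votes_le:
  "(\<Sum>i\<in>{1..n}. \<Sum>l\<in>{1..m}. counted_votes n m M A i l)
     \<le> real r * (\<Sum>i\<in>{1..n}. counted_votes n m M A i (group_choice A i))"
proof -
  have "(\<Sum>i\<in>{1..n}. \<Sum>l\<in>{1..m}. counted_votes n m M A i l)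
      = (\<Sum>b<h. \<Sum>i\<in>{i\<in>{1..n}. g i = b}. \<Sum>s<r. counted_votes n m M A i (job s i))"
    unfolding sum_over_groups sum_counted_votes_job ..
  also have "\<dots> = (\<Sum>b<h. \<Sum>s<r. group_value A b s)"
    unfolding group_value_def by (intro sum.cong refl sum.swap)
  also have "\<dots> \<le> (\<Sum>b<h. \<Sum>s<r. group_value A b (best_shift A b))"
    by (intro sum_mono group_value_best_shift) auto
  also have "\<dots> = real r * (\<Sum>b<h. group_value A b (best_shift A b))"
    by (simp add: sum_distrib_left)
  also have "(\<Sum>b<h. group_value A b (best_shift A b))
      = (\<Sum>b<h. \<Sum>i\<in>{i\<in>{1..n}. g i = b}. counted_votes n m M A i (group_choice A i))"
    unfolding group_value_def group_choice_def by (intro sum.cong) auto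
  finally show ?thesis
    unfolding sum_over_groups .
qed

text \<open>The members of a group share one shift and have distinct slots, so a job receives at
  most one agent per group.\<close>

lemma card_group_choice_le: "card {i\<in>{1..n}. group_choice A i = l} \<le> h"
proof -
  have "inj_on g {i\<in>{1..n}. group_choice A i = l}"
  proof (rule inj_onI, clarify)
    fix i j
    assume ij: "i \<in> {1..n}" "j \<in> {1..n}" "g i = g j" "group_choice A j = group_choice A i"
    then have "(c j + best_shift A (g i)) mod r = (c i + best_shift A (g i)) mod r"
      by (simp add: group_choice_def job_def)
    then have "c j mod r = c i mod r"
      using cong_add_rcancel_nat[of "c j" _ "c i" r] by (simp add: cong_def)
    then show "i = j"
      using slots_distinct[OF ij(1-3)] c_less by simp
  qed
  moreover have "g ` {i\<in>{1..n}. group_choice A i = l} \<subseteq> {..<h}"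
    using g_less by auto
  ultimately show ?thesis
    using card_inj_on_le[of g _ "{..<h}"] by simp
qed

text \<open>Row \<open>i\<close> is never read for any \<open>x\<close> in the group of
  \<open>i\<close>. All such \<open>x\<close> matter, since the shift is chosen from the value of
  the whole group.\<close>

lemma counted_votes_impartial:
  assumes "i \<in> {1..n}" "x \<in> {1..n}" "g x = g i"
    and "\<And>l. l \<in> {1..m} \<Longrightarrow> remove_row n i (A l) = remove_row n i (A' l)"
  shows "counted_votes n m M A x = counted_votes n m M A' x"
proof (rule counted_votes_cong)
  fix l j assume lj: "l \<in> {1..m}" "j \<in> {1..n}" "M j x"
  then have "j \<noteq> i"
    using counted_across[of x j] assms(2,3) by auto
  then show "A l j = A' l j"
    using remove_row_eqD[OF assms(4)] lj by blast
qed

text \<open>\<open>best_shift\<close> sees the instance only through the function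
  \<open>group_value A b\<close>, so even ties are broken in the same way.\<close>

lemma group_choice_impartial:
  assumes "i \<in> {1..n}"
    and "\<And>l. l \<in> {1..m} \<Longrightarrow> remove_row n i (A l) = remove_row n i (A' l)"
  shows "group_choice A i = group_choice A' i"
proof -
  have "group_value A (g i) = group_value A' (g i)"
    unfolding group_value_def fun_eq_iff
    using counted_votes_impartial[OF assms(1) _ _ assms(2)] by (auto intro!: sum.cong)
  then show ?thesis
    by (simp add: group_choice_def best_shift_def)
qed

end

section \<open>Scores and the total of all votes\<close>

lemma score_assignment:
  "score n m (restrict (\<lambda>l. {i\<in>{1..n}. F i = l}) {1..m}) A
     = (\<Sum>i\<in>{1..n}. if F i \<in> {1..m} then \<Sum>j\<in>{1..n}. A (F i) j i else 0)"
proof -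
  have "score n m (restrict (\<lambda>l. {i\<in>{1..n}. F i = l}) {1..m}) A
      = (\<Sum>l\<in>{1..m}. \<Sum>i\<in>{i\<in>{1..n}. F i = l}. \<Sum>j\<in>{1..n}. A l j i)"
    unfolding score_def score_set_def by (rule sum.cong[OF refl], subst sum.swap) simp
  also have "\<dots> = (\<Sum>l\<in>{1..m}. \<Sum>i\<in>{1..n}. if F i = l then \<Sum>j\<in>{1..n}. A l j i else 0)"
    by (intro sum.cong refl sum.inter_filter) simp
  also have "\<dots> = (\<Sum>i\<in>{1..n}. \<Sum>l\<in>{1..m}. if F i = l then \<Sum>j\<in>{1..n}. A l j i else 0)"
    by (rule sum.swap)
  finally show ?thesis
    by (simp add: sum.delta')
qed

text \<open>Votes are nonnegative, so enlarging every \<open>X l\<close> to all agents cannot lower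
  the score. This total serves as the upper bound on the optimum.\<close>

lemma score_le_total:
  assumes "A \<in> instances n m" "X \<in> feasible n m k"
  shows "score n m X A \<le> (\<Sum>l\<in>{1..m}. \<Sum>i\<in>{1..n}. \<Sum>j\<in>{1..n}. A l j i)"
proof -
  have "score_set n (X l) (A l) \<le> (\<Sum>j\<in>{1..n}. \<Sum>i\<in>{1..n}. A l j i)" if "l \<in> {1..m}" for l
    unfolding score_set_def
  proof (intro sum_mono sum_mono2)
    show "X l \<subseteq> {1..n}"
      using assms(2) that by (auto simp: feasible_def PiE_iff)
  qed (use assms(1) that instances_nonneg in auto)
  then have "score n m X A \<le> (\<Sum>l\<in>{1..m}. \<Sum>j\<in>{1..n}. \<Sum>i\<in>{1..n}. A l j i)"
    unfolding score_def by (intro sum_mono)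
  also have "\<dots> = (\<Sum>l\<in>{1..m}. \<Sum>i\<in>{1..n}. \<Sum>j\<in>{1..n}. A l j i)"
    by (intro sum.cong refl sum.swap)
  finally show ?thesis .
qed

section \<open>Combining two partitions\<close>

locale two_groupings =
  G: slotted_groups n m r h g c M + G': slotted_groups n m r h g' c' M'
  for n m r h :: nat and g c g' c' :: "nat \<Rightarrow> nat" and M M' :: "nat \<Rightarrow> nat \<Rightarrow> bool" +
  assumes counted_once: "\<lbrakk>i \<in> {1..n}; j \<in> {1..n}; i \<noteq> j\<rbrakk> \<Longrightarrow> M j i \<longleftrightarrow> \<not> M' j i"
begin

text \<open>Each candidate job is valued by the votes that its own partition counts; the larger of
  the two values is at least half of their sum.\<close>

definition agent_choice :: "inst \<Rightarrow> nat \<Rightarrow> nat" where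
  "agent_choice A i =
     (if counted_votes n m M' A i (G'.group_choice A i) \<le> counted_votes n m M A i (G.group_choice A i)
      then G.group_choice A i else G'.group_choice A i)"

definition mechanism :: "inst \<Rightarrow> assignment" where
  "mechanism A = restrict (\<lambda>l. {i\<in>{1..n}. agent_choice A i = l}) {1..m}"

lemma card_agent_choice_le: "card {i\<in>{1..n}. agent_choice A i = l} \<le> 2 * h"
proof -
  let ?S = "{i\<in>{1..n}. G.group_choice A i = l}" and ?S' = "{i\<in>{1..n}. G'.group_choice A i = l}"
  have "card {i\<in>{1..n}. agent_choice A i = l} \<le> card (?S \<union> ?S')"
    by (rule card_mono) (auto simp: agent_choice_def)
  also have "\<dots> \<le> card ?S + card ?S'"
    by (rule card_Un_le)
  also have "\<dots> \<le> 2 * h"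
    using G.card_group_choice_le[of A l] G'.card_group_choice_le[of A l] by simp
  finally show ?thesis .
qed

lemma assignment_mechanism_mechanism:
  assumes "2 * h \<le> k"
  shows "assignment_mechanism n m k mechanism"
  unfolding assignment_mechanism_def
proof
  fix A
  show "mechanism A \<in> feasible n m k"
    using order_trans[OF card_agent_choice_le assms]
    by (auto simp: feasible_def mechanism_def disjoint_family_on_def)
qed

lemma impartial_mechanism: "impartial n m mechanism"
  unfolding impartial_def
proof (intro ballI impI)
  fix A A' i l
  assume i: "i \<in> {1..n}" and l: "l \<in> {1..m}"
    and "\<forall>l\<in>{1..m}. remove_row n i (A l) = remove_row n i (A' l)"
  then have eq: "\<And>l. l \<in> {1..m} \<Longrightarrow> remove_row n i (A l) = remove_row n i (A' l)"
    by blast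
  have "G.group_choice A i = G.group_choice A' i" "G'.group_choice A i = G'.group_choice A' i"
    using G.group_choice_impartial[OF i] G'.group_choice_impartial[OF i] eq by blast+
  \<comment> \<open>Equal candidate jobs do not suffice: the values compared in
    \<open>agent_choice\<close> must agree as well.\<close>
  moreover have "counted_votes n m M A i = counted_votes n m M A' i"
    "counted_votes n m M' A i = counted_votes n m M' A' i"
    using G.counted_votes_impartial[OF i i refl] G'.counted_votes_impartial[OF i i refl] eq by blast+
  ultimately have "agent_choice A i = agent_choice A' i"
    by (simp add: agent_choice_def)
  then show "mechanism A l \<inter> {i} = mechanism A' l \<inter> {i}"
    using l by (auto simp: mechanism_def)
qed

lemma counted_votes_total:
  assumes A: "A \<in> instances n m" and i: "i \<in> {1..n}" and l: "l \<in> {1..m}"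
  shows "counted_votes n m M A i l + counted_votes n m M' A i l = (\<Sum>j\<in>{1..n}. A l j i)"
proof -
  have "counted_votes n m M A i l + counted_votes n m M' A i l
      = (\<Sum>j\<in>{1..n}. (if M j i then A l j i else 0) + (if M' j i then A l j i else 0))"
    using l by (simp only: counted_votes_def sum.inter_filter sum.distrib finite_atLeastAtMost if_True)
  also have "\<dots> = (\<Sum>j\<in>{1..n}. A l j i)"
  proof (rule sum.cong[OF refl])
    fix j assume "j \<in> {1..n}"
    then show "(if M j i then A l j i else 0) + (if M' j i then A l j i else 0) = A l j i"
      \<comment> \<open>\<open>counted_once\<close> says nothing about \<open>i = j\<close>; there
        the vote itself is 0.\<close>
      using counted_once[OF i, of j] instances_diagonal[OF A l i] by (cases "i = j") auto
  qed
  finally show ?thesis .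
qed

text \<open>Each partition loses a factor \<open>r\<close> on the votes it counts, and keeping one
  of the two jobs loses a factor 2.\<close>

lemma total_le_score_mechanism:
  assumes A: "A \<in> instances n m"
  shows "(\<Sum>l\<in>{1..m}. \<Sum>i\<in>{1..n}. \<Sum>j\<in>{1..n}. A l j i) \<le> 2 * real r * score n m (mechanism A) A"
proof -
  let ?v = "\<lambda>i. counted_votes n m M A i (G.group_choice A i)"
  let ?v' = "\<lambda>i. counted_votes n m M' A i (G'.group_choice A i)"
  let ?gain = "\<lambda>i. if agent_choice A i \<in> {1..m} then \<Sum>j\<in>{1..n}. A (agent_choice A i) j i else 0"
  have gain: "?v i + ?v' i \<le> 2 * ?gain i" if i: "i \<in> {1..n}" for i
  proof -
    have le_gain: "counted_votes n m N A i (agent_choice A i) \<le> ?gain i" for N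
      using counted_votes_le[OF A i] by (auto simp: counted_votes_def)
    \<comment> \<open>The chosen job attains the larger of \<open>?v i\<close> and
      \<open>?v' i\<close> under the relation of the partition it comes from.\<close>
    have "?v i + ?v' i \<le> 2 * max (counted_votes n m M A i (agent_choice A i))
        (counted_votes n m M' A i (agent_choice A i))"
      by (auto simp: agent_choice_def max_def)
    also have "\<dots> \<le> 2 * ?gain i"
      using le_gain[of M] le_gain[of M'] by linarith
    finally show ?thesis .
  qed
  have "(\<Sum>l\<in>{1..m}. \<Sum>i\<in>{1..n}. \<Sum>j\<in>{1..n}. A l j i)
      = (\<Sum>i\<in>{1..n}. \<Sum>l\<in>{1..m}. counted_votes n m M A i l + counted_votes n m M' A i l)"
    by (subst sum.swap) (intro sum.cong refl counted_votes_total[OF A, symmetric])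
  also have "\<dots> \<le> real r * (\<Sum>i\<in>{1..n}. ?v i) + real r * (\<Sum>i\<in>{1..n}. ?v' i)"
    unfolding sum.distrib by (intro add_mono G.sum_counted_votes_le G'.sum_counted_votes_le)
  also have "\<dots> = real r * (\<Sum>i\<in>{1..n}. ?v i + ?v' i)"
    by (simp add: sum.distrib distrib_left)
  also have "\<dots> \<le> real r * (\<Sum>i\<in>{1..n}. 2 * ?gain i)"
    by (intro mult_left_mono sum_mono gain) auto
  also have "\<dots> = 2 * real r * score n m (mechanism A) A"
    unfolding mechanism_def score_assignment sum_distrib_left[symmetric] by simp
  finally show ?thesis .
qed

lemma optimal_mechanism_mechanism:
  assumes "0 \<le> \<alpha>" "\<alpha> * (2 * real r) \<le> 1"
  shows "optimal_mechanism n m k \<alpha> mechanism"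
  unfolding optimal_mechanism_def
proof
  fix A assume A: "A \<in> instances n m"
  let ?s = "score n m (mechanism A) A"
  have total: "score n m (OPT n m k A) A \<le> 2 * real r * ?s"
    using score_le_total[OF A] total_le_score_mechanism[OF A] OPT_maximizes[of n m k A]
    by (meson order_trans)
  \<comment> \<open>The sign of \<open>?s\<close> follows from the bound just used, as 0 \<le> total
    \<le> \<open>2 * real r * ?s\<close>.\<close>
  have "0 \<le> (\<Sum>l\<in>{1..m}. \<Sum>i\<in>{1..n}. \<Sum>j\<in>{1..n}. A l j i)"
    by (intro sum_nonneg instances_nonneg[OF A])
  with total_le_score_mechanism[OF A] G.r_pos have "0 \<le> ?s"
    by (smt (verit, best) mult_pos_neg of_nat_0_less_iff zero_less_mult_iff)
  have "\<alpha> * score n m (OPT n m k A) A \<le> \<alpha> * (2 * real r) * ?s"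
    using mult_left_mono[OF total assms(1)] by (simp add: mult.assoc)
  also have "\<dots> \<le> ?s"
    using mult_right_mono[OF assms(2) \<open>0 \<le> ?s\<close>] by simp
  finally show "\<alpha> * score n m (OPT n m k A) A \<le> ?s" .
qed

end

section \<open>Rows and cyclic diagonals of the grid\<close>

text \<open>Both partitions use the column as slot: a row, like a diagonal, meets each column at
  most once. Distinct agents of one row lie on distinct diagonals, so the diagonals can count the
  votes within rows.\<close>

lemma two_groupings_grid:
  fixes n m r h :: nat
  defines "row \<equiv> \<lambda>i. (i - 1) div r" and "col \<equiv> \<lambda>i. (i - 1) mod r"
  assumes "0 < r" "m \<le> r" "r \<le> h" "n \<le> r * h"
  shows "two_groupings n m r h row col (\<lambda>i. (row i + col i) mod h) col
           (\<lambda>j i. row j \<noteq> row i) (\<lambda>j i. row j = row i \<and> j \<noteq> i)"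
proof -
  have row_less: "row i < h" if "i \<in> {1..n}" for i
    using that assms by (auto simp: row_def div_less_iff_less_mult mult.commute)
  have col_less: "col i < r" for i
    using assms by (simp add: col_def)
  have cell: "i = j" if "i \<in> {1..n}" "j \<in> {1..n}" "row i = row j" "col i = col j" for i j
  proof -
    have "i - 1 = j - 1"
      using that(3,4) unfolding row_def col_def by (metis div_mult_mod_eq)
    then show ?thesis
      using that(1,2) by auto
  qed
  have same_col: "row i = row j"
    if "i \<in> {1..n}" "j \<in> {1..n}" "(row i + col i) mod h = (row j + col j) mod h" "col i = col j" for i j
  proof -
    have "row i mod h = row j mod h"
      using that(3,4) cong_add_rcancel_nat[of "row i" "col j" "row j" h] by (simp add: cong_def)
    then show ?thesis
      using row_less[OF that(1)] row_less[OF that(2)] by simp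
  qed
  \<comment> \<open>Columns are below \<open>r\<close>, so \<open>r \<le> h\<close> lets them be
    recovered from their residues modulo \<open>h\<close>.\<close>
  have same_row: "col i = col j"
    if "(row i + col i) mod h = (row j + col j) mod h" "row i = row j" for i j
  proof -
    have "col i mod h = col j mod h"
      using that cong_add_lcancel_nat[of "row j" "col i" "col j" h] by (simp add: cong_def)
    then show ?thesis
      using col_less[of i] col_less[of j] \<open>r \<le> h\<close> by simp
  qed
  have h_pos: "0 < h"
    using \<open>0 < r\<close> \<open>r \<le> h\<close> by simp
  show ?thesis
  proof (intro two_groupings.intro slotted_groups.intro two_groupings_axioms.intro)
    fix i j
    assume ij: "i \<in> {1..n}" "j \<in> {1..n}"
    show "i = j" if "(row i + col i) mod h = (row j + col j) mod h" "col i = col j"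
      using cell[OF ij same_col[OF ij that] that(2)] .
    show "(row j + col j) mod h \<noteq> (row i + col i) mod h" if "row j = row i \<and> j \<noteq> i"
      using that cell[OF ij(2,1)] same_row[of j i] by blast
    show "i = j" if "row i = row j" "col i = col j"
      using cell[OF ij that] .
    show "row j \<noteq> row i \<longleftrightarrow> \<not> (row j = row i \<and> j \<noteq> i)" if "i \<noteq> j"
      using that by blast
  qed (rule assms(3) assms(4) row_less col_less mod_less_divisor[OF h_pos] | assumption)+
qed

section \<open>Choice of the parameters\<close>

theorem theorem5p1:
  fixes n m k :: nat
  assumes "n > 0" and "m > 0" and "1 < k" and "k < n"
    and "m * k \<le> 2 * n"
    and "real (k - k mod 2) \<ge> 2 * sqrt (real n)"
  shows "\<exists>f. assignment_mechanism n m k f \<and> impartial n m f \<and>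
           optimal_mechanism n m k
             (real (k - k mod 2) /
               (2 * real k * of_int \<lceil>2 * real n / real (k - k mod 2)\<rceil>)) f"
proof -
  define h where "h = k div 2"
  define r where "r = nat \<lceil>2 * real n / real (k - k mod 2)\<rceil>"
  have even_part: "k - k mod 2 = 2 * h"
    unfolding h_def by (simp add: minus_mod_eq_mult_div)
  have h_pos: "0 < h" and two_h: "2 * h \<le> k"
    using \<open>1 < k\<close> by (auto simp: h_def)
  have quot: "2 * real n / real (k - k mod 2) = real n / real h"
    by (simp add: even_part)
  have "0 < real n / real h"
    using \<open>n > 0\<close> h_pos by simp
  then have r_pos: "0 < r" and r_eq: "of_int \<lceil>2 * real n / real (k - k mod 2)\<rceil> = real r"
    unfolding r_def quot by auto
  have quot_le: "real n / real h \<le> real r"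
    unfolding r_eq[symmetric] quot by simp
  then have "real n \<le> real (r * h)"
    using h_pos by (simp add: field_simps)
  then have n_le: "n \<le> r * h"
    by linarith
  \<comment> \<open>The lower bound on \<open>k\<close> gives \<open>n / h \<le> h\<close>; as
    \<open>h\<close> is an integer, rounding up preserves this.\<close>
  have "sqrt (real n) \<le> real h"
    using assms(6) by (simp add: even_part)
  then have "real n \<le> (real h)\<^sup>2"
    by (rule sqrt_le_D)
  then have "real n / real h \<le> real h"
    using h_pos by (simp add: field_simps power2_eq_square)
  then have r_le: "r \<le> h"
    unfolding r_def quot by (simp add: ceiling_le_iff)
  \<comment> \<open>Since \<open>m * h \<le> n \<le> r * h\<close>, the \<open>r\<close> slots of a
    group suffice for all \<open>m\<close> jobs.\<close>
  have "m * (2 * h) \<le> 2 * n"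
    using assms(5) two_h by (meson le_trans mult_le_mono2)
  then have "m * h \<le> r * h"
    using n_le by linarith
  then have m_le: "m \<le> r"
    using h_pos by simp
  interpret two_groupings n m r h "\<lambda>i. (i - 1) div r" "\<lambda>i. (i - 1) mod r"
    "\<lambda>i. ((i - 1) div r + (i - 1) mod r) mod h" "\<lambda>i. (i - 1) mod r"
    "\<lambda>j i. (j - 1) div r \<noteq> (i - 1) div r" "\<lambda>j i. (j - 1) div r = (i - 1) div r \<and> j \<noteq> i"
    by (rule two_groupings_grid[OF r_pos m_le r_le n_le])
  let ?\<alpha> = "real (k - k mod 2) / (2 * real k * of_int \<lceil>2 * real n / real (k - k mod 2)\<rceil>)"
  \<comment> \<open>The mechanism guarantees \<open>1 / (2 * r)\<close>; the required ratio is this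
    times \<open>2 * h / k\<close>, which is at most 1.\<close>
  have "?\<alpha> * (2 * real r) = real (2 * h) / real k"
    unfolding r_eq unfolding even_part using r_pos by (simp add: field_simps)
  also have "\<dots> \<le> 1"
    using two_h \<open>1 < k\<close> by (simp del: of_nat_mult)
  finally have "optimal_mechanism n m k ?\<alpha> mechanism"
    by (rule optimal_mechanism_mechanism[rotated]) (simp only: r_eq, simp)
  then show ?thesis
    using assignment_mechanism_mechanism[OF two_h] impartial_mechanism by blast
qed

end
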